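(* Let $n\ge 1$ and let $S$ be any finite symmetric projection-symmetric generating set, containing the identity, of the generalized Heisenberg group $H_{2n+1}$. Then there is an $S$-horoball $P \subset H_{2n+1}$ which is not a limit of Busemann horoballs (with respect to $S$), i.e. no sequence of Busemann horoballs converges to $P$.
   Context: The generalized discrete Heisenberg group $H_{2n+1}$ is the set of $(a,b,c)\in\mathbb{Z}^n\times\mathbb{Z}^n\times\mathbb{Z}$ such that $2\mid c \iff 2\mid a\cdot b$, with product $(a,b,c)(a',b',c') = (a+a', b+b', c+c' + (a\cdot b' - a'\cdot b))$. A generating set $S$ of $H_{2n+1}$ is projection-symmetric if it is fixed (as a set) by the projection flip $(a,b,c)\mapsto(-a,-b,c)$. Symmetric means $S = \{s^{-1} : s\in S\}$. For a group $G$ with finite symmetric generating set $S\ni e_G$, $|g|_S$ is the minimal $\ell\ge0$ such that $g$ is a product of $\ell$ elements of $S$, $d_S(g,h) = |g^{-1}h|_S$, and $B_{S,r}(g) = \{h : d_S(g,h)\le r\}$. Subsets of $G$ carry the product (Cantor) topology of $\{0,1\}^G$: $P_i\to P$ means that for each $g\in G$, $g\in P_i\iff g\in P$ for all large $i$. An infinite geodesic is a map $p:\mathbb{N}\to G$ with $p(i+1)\in p(i)S$ for all $i$ and $d_S(p(0),p(m)) = m$ for all $m$. Let $P\subset G$ with $P\ne\emptyset, G$. $P$ is a Busemann horoball if $P = \bigcup_m B_{S,m}(p(m))$ for some infinite geodesic $p$. $P$ is an $S$-horoball if $P = \lim_i B_{S,m_i}(g_i)$ for some $g_i\in G$, $m_i\in\mathbb{N}$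 with $m_i\to\infty$. *)

theory Defs
  imports "HOL-Analysis.Finite_Cartesian_Product" "HOL-Algebra.Generated_Groups"
begin

definition int_dot :: "int ^ 'n \<Rightarrow> int ^ 'n \<Rightarrow> int" where
  "int_dot a b = (\<Sum>i\<in>UNIV. a $ i * b $ i)"

type_synonym 'n heis_elt = "(int ^ 'n) \<times> (int ^ 'n) \<times> int"

text \<open>The generalized discrete Heisenberg group of rank \<open>2n + 1\<close>, where \<open>n\<close> is the cardinality
  of the index type (at least 1, as types are nonempty).\<close>

definition heisenberg :: "'n::finite heis_elt monoid" where
  "heisenberg =
     \<lparr>carrier = {(a, b, c). 2 dvd c \<longleftrightarrow> 2 dvd int_dot a b},
      mult = (\<lambda>(a, b, c) (a', b', c'). (a + a', b + b', c + c' + (int_dot a b' - int_dot a' b))),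
      one = (0, 0, 0)\<rparr>"

definition projection_flip :: "'n::finite heis_elt \<Rightarrow> 'n heis_elt" where
  "projection_flip = (\<lambda>(a, b, c). (- a, - b, c))"

definition word_length :: "('g, 'm) monoid_scheme \<Rightarrow> 'g set \<Rightarrow> 'g \<Rightarrow> nat" where
  "word_length G S g =
     (LEAST l. \<exists>ws. length ws = l \<and> set ws \<subseteq> S \<and> foldr (\<otimes>\<^bsub>G\<^esub>) ws \<one>\<^bsub>G\<^esub> = g)"

definition word_dist :: "('g, 'm) monoid_scheme \<Rightarrow> 'g set \<Rightarrow> 'g \<Rightarrow> 'g \<Rightarrow> nat" where
  "word_dist G S g h = word_length G S (inv\<^bsub>G\<^esub> g \<otimes>\<^bsub>G\<^esub> h)"

definition word_ball :: "('g, 'm) monoid_scheme \<Rightarrow> 'g set \<Rightarrow> nat \<Rightarrow> 'g \<Rightarrow> 'g set" where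
  "word_ball G S r g = {h \<in> carrier G. word_dist G S g h \<le> r}"

text \<open>Convergence in the product topology on subsets of the carrier, written out pointwise.\<close>

definition converges_to :: "('g, 'm) monoid_scheme \<Rightarrow> (nat \<Rightarrow> 'g set) \<Rightarrow> 'g set \<Rightarrow> bool" where
  "converges_to G Q P \<longleftrightarrow>
     (\<forall>g\<in>carrier G. eventually (\<lambda>i. g \<in> Q i \<longleftrightarrow> g \<in> P) sequentially)"

definition infinite_geodesic :: "('g, 'm) monoid_scheme \<Rightarrow> 'g set \<Rightarrow> (nat \<Rightarrow> 'g) \<Rightarrow> bool" where
  "infinite_geodesic G S p \<longleftrightarrow>
     (\<forall>i. p i \<in> carrier G) \<and>
     (\<forall>i. p (Suc i) \<in> p i <#\<^bsub>G\<^esub> S) \<and>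
     (\<forall>m. word_dist G S (p 0) (p m) = m)"

definition busemann_horoball :: "('g, 'm) monoid_scheme \<Rightarrow> 'g set \<Rightarrow> 'g set \<Rightarrow> bool" where
  "busemann_horoball G S P \<longleftrightarrow>
     P \<subseteq> carrier G \<and> P \<noteq> {} \<and> P \<noteq> carrier G \<and>
     (\<exists>p. infinite_geodesic G S p \<and> P = (\<Union>m. word_ball G S m (p m)))"

definition horoball :: "('g, 'm) monoid_scheme \<Rightarrow> 'g set \<Rightarrow> 'g set \<Rightarrow> bool" where
  "horoball G S P \<longleftrightarrow>
     P \<subseteq> carrier G \<and> P \<noteq> {} \<and> P \<noteq> carrier G \<and>
     (\<exists>g m. (\<forall>i. g i \<in> carrier G) \<and> filterlim m at_top sequentially \<and>
            converges_to G (\<lambda>i. word_ball G S (m i) (g i)) P)"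

lemma int_dot_simps:
  "int_dot (a + a') b = int_dot a b + int_dot a' b"
  "int_dot a (b + b') = int_dot a b + int_dot a b'"
  "int_dot (- a) b = - int_dot a b"
  "int_dot a (- b) = - int_dot a b"
  "int_dot 0 b = 0"
  "int_dot a 0 = 0"
  by (simp_all add: int_dot_def algebra_simps sum.distrib sum_negf)

lemma group_heisenberg: "group (heisenberg :: 'n::finite heis_elt monoid)"
proof (rule groupI, goal_cases)
  case (1 x y)
  then show ?case
    by (auto simp: heisenberg_def int_dot_simps)
next
  case (5 x)
  obtain a b c where x: "x = (a, b, c)" by (cases x)
  show ?case
    by (rule bexI[of _ "(- a, - b, - c)"])
      (use 5 in \<open>simp_all add: x heisenberg_def int_dot_simps\<close>)
qed (auto simp: heisenberg_def int_dot_simps algebra_simps)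

end

theory Submission
  imports Defs "HOL-Library.Product_Plus" "HOL-Library.Diagonal_Subsequence"
begin

text \<open>
  The projection flip is an automorphism fixing the centre and preserving \<open>S\<close>, so the balls
  of radius \<open>\<bar>z\<bar> - k - 1\<close> around central elements \<open>z\<close> tending to infinity accumulate at a
  flip-invariant horoball \<open>P\<close> which misses the ball of radius \<open>k\<close> around the identity
  but meets the ball of radius \<open>k + 1\<close>.

  A Busemann horoball cannot look like that when \<open>k\<close> is large. If it contains \<open>g\<close> and its flip,
  then for large \<open>M\<close> both are at distance at most \<open>M\<close> from \<open>p M\<close>. Taking half of the letters of the
  two words leading there gives an element of length at most \<open>M + C\<^sub>1\<close> with the same projection as
  \<open>p M\<close>, because the projections of \<open>g\<close> and its flip cancel. Only the central coordinate is
  wrong. It is corrected at bounded cost \<open>C\<^sub>2\<close>: conjugating a later stretch \<open>v\<close> of the geodesic by a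
  generator \<open>z\<close> shifts the centre by twice the symplectic form of \<open>z\<close> and \<open>v\<close>, which is unbounded
  along the geodesic and changes by bounded steps. Hence \<open>\<bar>p m\<bar> \<le> m + C\<^sub>1 + C\<^sub>2\<close> for some \<open>m\<close>, and
  the horoball meets the ball of radius \<open>C\<^sub>1 + C\<^sub>2\<close>. That the projection of an infinite geodesic
  is unbounded holds because the length of central elements grows sublinearly in their last coordinate.
\<close>

section \<open>Finite bounds and compactness of the space of subsets\<close>

lemma finite_bounded_nat:
  fixes f :: "'a \<Rightarrow> nat"
  assumes "finite A"
  obtains K where "\<And>x. x \<in> A \<Longrightarrow> f x \<le> K"
  using assms finite_nat_set_iff_bounded_le[of "f ` A"] by auto

lemma finite_bounded_int:
  fixes f :: "'a \<Rightarrow> int"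
  assumes "finite A"
  obtains K where "K \<ge> 0" "\<And>x. x \<in> A \<Longrightarrow> \<bar>f x\<bar> \<le> K"
proof -
  obtain K where "\<And>x. x \<in> A \<Longrightarrow> nat \<bar>f x\<bar> \<le> K"
    using finite_bounded_nat[OF assms, of "\<lambda>x. nat \<bar>f x\<bar>"] by blast
  then show ?thesis
    by (intro that[of "int K"]) force+
qed

text \<open>This is sequential compactness of the Cantor space of subsets of \<open>A\<close>, by a
  diagonal argument over an enumeration of \<open>A\<close>.\<close>

lemma countable_set_sequence_convergent_subsequence:
  fixes B :: "nat \<Rightarrow> 'a set"
  assumes "countable A"
  obtains r P where "strict_mono r" "P \<subseteq> A"
    "\<And>x. x \<in> A \<Longrightarrow> eventually (\<lambda>i. x \<in> B (r i) \<longleftrightarrow> x \<in> P) sequentially"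
proof (cases "A = {}")
  case True
  then show ?thesis using that[of id "{}"] by (auto simp: strict_mono_def)
next
  case False
  define e where "e = from_nat_into A"
  have range_e: "range e = A"
    unfolding e_def using assms False by (rule range_from_nat_into[rotated])
  \<comment> \<open>\<open>R n s\<close>: membership of the \<open>n\<close>-th point is constant
    along \<open>s\<close>. Every subsequence inherits this, which is what
    \<open>diagseq_holds\<close> asks for.\<close>
  define R where "R n s \<longleftrightarrow> (\<exists>b. \<forall>i. (e n \<in> B (s i)) = b)" for n and s :: "nat \<Rightarrow> nat"
  interpret subseqs R
  proof
    fix n and s :: "nat \<Rightarrow> nat"
    define I where "I b = {i. (e n \<in> B (s i)) = b}" for b
    have "I True \<union> I False = UNIV" by (auto simp: I_def)
    then obtain b where "infinite (I b)"
      using finite_UnI[of "I True" "I False"] infinite_UNIV_nat by auto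
    then obtain r :: "nat \<Rightarrow> nat" where "strict_mono r" "\<forall>i. r i \<in> I b"
      using infinite_enumerate[of "I b"] by auto
    then show "\<exists>r'. strict_mono r' \<and> R n (s \<circ> r')"
      by (auto simp: R_def I_def)
  qed
  have "\<exists>b. eventually (\<lambda>i. (e n \<in> B (diagseq i)) = b) sequentially" for n
  proof -
    have "R n (diagseq \<circ> ((+) (Suc n)))"
    proof (rule diagseq_holds)
      fix x s
      assume "R x s"
      then show "R x (s \<circ> r)" for r by (auto simp: R_def)
    qed
    then obtain b where b: "\<And>i. (e n \<in> B (diagseq (Suc n + i))) = b"
      by (auto simp: R_def)
    have "(e n \<in> B (diagseq i)) = b" if "i \<ge> Suc n" for i
      using b[of "i - Suc n"] that by simp
    then show ?thesis
      using eventually_sequentially by blast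
  qed
  then obtain b where b: "\<And>n. eventually (\<lambda>i. (e n \<in> B (diagseq i)) = b n) sequentially"
    by metis
  define P where "P = {x \<in> A. eventually (\<lambda>i. x \<in> B (diagseq i)) sequentially}"
  have "eventually (\<lambda>i. x \<in> B (diagseq i) \<longleftrightarrow> x \<in> P) sequentially" if xA: "x \<in> A" for x
  proof -
    obtain n where x: "x = e n" using range_e xA by auto
    show ?thesis
    proof (cases "b n")
      case True
      then show ?thesis using b[of n] xA by (simp add: P_def x)
    next
      case False
      then have ev: "eventually (\<lambda>i. x \<notin> B (diagseq i)) sequentially"
        using b[of n] by (simp add: x)
      then have "\<not> eventually (\<lambda>i. x \<in> B (diagseq i)) sequentially"
        using eventually_happens'[OF sequentially_bot, OF eventually_conj[OF ev]] by blast
      then show ?thesis using ev by (simp add: P_def)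
    qed
  qed
  then show ?thesis
    using that[of diagseq P] subseq_diagseq by (auto simp: P_def)
qed

section \<open>Word length and word metric of a finite symmetric generating set\<close>

locale symmetric_generators = group G for G (structure) +
  fixes S
  assumes finite_S: "finite S"
    and S_subset: "S \<subseteq> carrier G"
    and generate_S: "generate G S = carrier G"
    and inv_S: "s \<in> S \<Longrightarrow> inv s \<in> S"
begin

abbreviation len where "len \<equiv> word_length G S"

abbreviation word_prod where "word_prod ws \<equiv> foldr (\<otimes>) ws \<one>"

lemma word_prod_closed: "set ws \<subseteq> S \<Longrightarrow> word_prod ws \<in> carrier G"
  using S_subset by (induction ws) auto

lemma word_prod_append:
  "set vs \<subseteq> S \<Longrightarrow> set ws \<subseteq> S \<Longrightarrow> word_prod (vs @ ws) = word_prod vs \<otimes> word_prod ws"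
proof (induction vs)
  case Nil
  then show ?case using word_prod_closed by simp
next
  case (Cons v vs)
  then show ?case using word_prod_closed S_subset by (auto simp: m_assoc subset_iff)
qed

lemma word_prod_rev_inv:
  "set ws \<subseteq> S \<Longrightarrow> word_prod (rev (map (m_inv G) ws)) = inv (word_prod ws)"
proof (induction ws)
  case (Cons w ws)
  have *: "w \<in> carrier G" "inv w \<in> S" "set (rev (map (m_inv G) ws)) \<subseteq> S"
    using Cons.prems S_subset inv_S by auto
  have "word_prod (rev (map (m_inv G) (w # ws))) =
      word_prod (rev (map (m_inv G) ws)) \<otimes> word_prod [inv w]"
    using word_prod_append[of "rev (map (m_inv G) ws)" "[inv w]"] * by simp
  then show ?case
    using Cons * word_prod_closed[of ws] by (simp add: inv_mult_group)
qed simp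

lemma len_le: "set ws \<subseteq> S \<Longrightarrow> len (word_prod ws) \<le> length ws"
  unfolding word_length_def by (rule Least_le) auto

text \<open>Closure of \<open>S\<close> under inverses turns membership in \<open>generate\<close>
  into plain words, so the \<open>LEAST\<close> in \<open>word_length\<close> is attained.\<close>

lemma ex_word:
  assumes "g \<in> carrier G"
  shows "\<exists>ws. length ws = len g \<and> set ws \<subseteq> S \<and> word_prod ws = g"
proof -
  have "\<exists>ws. set ws \<subseteq> S \<and> word_prod ws = g"
    using assms unfolding generate_S[symmetric]
  proof induction
    case one
    show ?case by (rule exI[of _ "[]"]) simp
  next
    case (incl h)
    then show ?case using S_subset by (intro exI[of _ "[h]"]) auto
  next
    case (inv h)
    then show ?case using S_subset inv_S by (intro exI[of _ "[inv h]"]) auto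
  next
    case (eng h1 h2)
    then show ?case by (metis word_prod_append set_append Un_subset_iff)
  qed
  then have "\<exists>l ws. length ws = l \<and> set ws \<subseteq> S \<and> word_prod ws = g"
    by blast
  then show ?thesis
    unfolding word_length_def by (rule LeastI_ex)
qed

lemma len_one: "len \<one> = 0"
  using len_le[of "[]"] by simp

lemma len_generator: "s \<in> S \<Longrightarrow> len s \<le> 1"
  using len_le[of "[s]"] S_subset by auto

lemma len_mult:
  assumes "g \<in> carrier G" "h \<in> carrier G"
  shows "len (g \<otimes> h) \<le> len g + len h"
proof -
  obtain vs ws where "length vs = len g" "set vs \<subseteq> S" "word_prod vs = g"
    "length ws = len h" "set ws \<subseteq> S" "word_prod ws = h"
    using ex_word assms by meson
  then show ?thesis
    using len_le[of "vs @ ws"] word_prod_append[of vs ws] by auto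
qed

lemma len_inv_le:
  assumes "g \<in> carrier G"
  shows "len (inv g) \<le> len g"
proof -
  obtain ws where ws: "length ws = len g" "set ws \<subseteq> S" "word_prod ws = g"
    using ex_word assms by meson
  then have "set (rev (map (m_inv G) ws)) \<subseteq> S" using inv_S by auto
  from len_le[OF this] show ?thesis using ws word_prod_rev_inv[of ws] by simp
qed

lemma len_inv: "g \<in> carrier G \<Longrightarrow> len (inv g) = len g"
  using len_inv_le[of g] len_inv_le[of "inv g"] by simp

lemma word_dist_commute:
  assumes "g \<in> carrier G" "h \<in> carrier G"
  shows "word_dist G S g h = word_dist G S h g"
  using len_inv[of "inv g \<otimes> h"] assms by (simp add: word_dist_def inv_mult_group)

lemma word_dist_one: "g \<in> carrier G \<Longrightarrow> word_dist G S \<one> g = len g"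
  by (simp add: word_dist_def)

lemma word_dist_triangle:
  assumes "g \<in> carrier G" "h \<in> carrier G" "k \<in> carrier G"
  shows "word_dist G S g k \<le> word_dist G S g h + word_dist G S h k"
proof -
  have "inv g \<otimes> k = (inv g \<otimes> h) \<otimes> (inv h \<otimes> k)"
    using assms by (simp add: m_assoc) (simp add: m_assoc[symmetric])
  then show ?thesis
    using len_mult[of "inv g \<otimes> h" "inv h \<otimes> k"] assms by (simp add: word_dist_def)
qed

text \<open>Cut a shortest word for \<open>g\<close> after \<open>k\<close> letters.\<close>

lemma len_split:
  assumes "g \<in> carrier G" "k \<le> len g"
  obtains h where "h \<in> carrier G" "len h \<le> k" "word_dist G S h g \<le> len g - k"
proof -
  obtain ws where ws: "length ws = len g" "set ws \<subseteq> S" "word_prod ws = g"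
    using ex_word assms by meson
  have sub: "set (take k ws) \<subseteq> S" "set (drop k ws) \<subseteq> S"
    using ws set_take_subset set_drop_subset by fastforce+
  have "g = word_prod (take k ws) \<otimes> word_prod (drop k ws)"
    using word_prod_append[OF sub] ws by (metis append_take_drop_id)
  then have "inv (word_prod (take k ws)) \<otimes> g = word_prod (drop k ws)"
    using sub word_prod_closed by (simp add: inv_solve_left')
  then show ?thesis
    using that[of "word_prod (take k ws)"] len_le[OF sub(1)] len_le[OF sub(2)]
      sub word_prod_closed ws assms by (simp add: word_dist_def)
qed

text \<open>There are only finitely many short words. This later upgrades pointwise convergence to
  simultaneous agreement on a whole ball.\<close>

lemma finite_len_ball: "finite {g \<in> carrier G. len g \<le> l}"
proof -
  have "{g \<in> carrier G. len g \<le> l} \<subseteq> word_prod ` {ws. set ws \<subseteq> S \<and> length ws \<le> l}"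
  proof
    fix g assume "g \<in> {g \<in> carrier G. len g \<le> l}"
    then show "g \<in> word_prod ` {ws. set ws \<subseteq> S \<and> length ws \<le> l}"
      using ex_word[of g] by force
  qed
  then show ?thesis
    using finite_lists_length_le[OF finite_S] finite_surj by blast
qed

lemma countable_carrier: "countable (carrier G)"
proof -
  have "carrier G = (\<Union>l. {g \<in> carrier G. len g \<le> l})" by auto
  then show ?thesis
    by (metis (no_types, lifting) countable_finite countable_UN[OF countableI_type] finite_len_ball)
qed

text \<open>Each step costs at most one letter. Hence the balls of radius \<open>m\<close> around
  \<open>p m\<close> increase with \<open>m\<close>.\<close>

lemma path_word_dist_le:
  assumes "\<And>i. p i \<in> carrier G" "\<And>i. p (Suc i) \<in> p i <# S" "M \<le> m"
  shows "word_dist G S (p M) (p m) \<le> m - M"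
  using assms(3)
proof (induction m rule: dec_induct)
  case base
  then show ?case using assms(1) by (simp add: word_dist_def len_one)
next
  case (step m)
  obtain s where s: "s \<in> S" "p (Suc m) = p m \<otimes> s"
    using assms(2)[of m] by (auto simp: l_coset_def)
  have "word_dist G S (p m) (p (Suc m)) = len s"
    using s assms(1)[of m] S_subset by (auto simp: word_dist_def m_assoc[symmetric])
  then show ?case
    using word_dist_triangle[of "p M" "p m" "p (Suc m)"] assms(1) len_generator[OF s(1)]
      step by (simp add: Suc_diff_le)
qed

end


section \<open>Projection, height and flip on the Heisenberg group\<close>

abbreviation heis_mult (infixl "\<cdot>" 70) where
  "g \<cdot> h \<equiv> g \<otimes>\<^bsub>heisenberg\<^esub> h"

abbreviation heis_inv where
  "heis_inv g \<equiv> inv\<^bsub>heisenberg\<^esub> g"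

definition proj :: "'n::finite heis_elt \<Rightarrow> (int ^ 'n) \<times> (int ^ 'n)" where
  "proj g = (fst g, fst (snd g))"

definition height :: "'n::finite heis_elt \<Rightarrow> int" where
  "height g = snd (snd g)"

text \<open>The standard symplectic form; a commutator of \<open>g\<close> and \<open>h\<close> has
  height twice \<open>symp (proj g) (proj h)\<close>.\<close>

definition symp :: "(int ^ 'n::finite) \<times> (int ^ 'n) \<Rightarrow> (int ^ 'n) \<times> (int ^ 'n) \<Rightarrow> int" where
  "symp u v = int_dot (fst u) (snd v) - int_dot (fst v) (snd u)"

text \<open>A set-theoretic section of the projection, not a homomorphism; this height has the
  parity required by the carrier.\<close>

definition lift :: "(int ^ 'n::finite) \<times> (int ^ 'n) \<Rightarrow> 'n heis_elt" where
  "lift u = (fst u, snd u, int_dot (fst u) (snd u))"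

definition vert :: "int \<Rightarrow> 'n::finite heis_elt" where
  "vert d = (0, 0, d)"

interpretation heis: group "heisenberg :: 'n::finite heis_elt monoid"
  by (rule group_heisenberg)

lemma int_dot_commute: "int_dot a b = int_dot b a"
  by (simp add: int_dot_def mult.commute)

lemma int_dot_diff:
  "int_dot (a - a') b = int_dot a b - int_dot a' b"
  "int_dot a (b - b') = int_dot a b - int_dot a b'"
  by (simp_all add: int_dot_def algebra_simps sum_subtractf)

lemma symp_simps:
  "symp (u + u') v = symp u v + symp u' v"
  "symp u (v + v') = symp u v + symp u v'"
  "symp (u - u') v = symp u v - symp u' v"
  "symp u (v - v') = symp u v - symp u v'"
  "symp (- u) v = - symp u v"
  "symp u (- v) = - symp u v"
  "symp 0 v = 0"
  "symp u 0 = 0"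
  "symp u u = 0"
  by (simp_all add: symp_def int_dot_simps int_dot_diff)

lemma symp_swap: "symp u v = - symp v u"
  by (simp add: symp_def int_dot_commute)

lemma heis_eqI: "proj g = proj h \<Longrightarrow> height g = height h \<Longrightarrow> g = h"
  by (simp add: proj_def height_def prod_eq_iff)

lemma heis_carrier_iff:
  "g \<in> carrier heisenberg \<longleftrightarrow> (even (height g) \<longleftrightarrow> even (int_dot (fst (proj g)) (snd (proj g))))"
  by (auto simp: heisenberg_def proj_def height_def)

lemma proj_mult [simp]: "proj (g \<cdot> h) = proj g + proj h"
  by (cases g; cases h) (simp add: proj_def heisenberg_def)

lemma height_mult: "height (g \<cdot> h) = height g + height h + symp (proj g) (proj h)"
  by (cases g; cases h) (simp add: proj_def height_def symp_def heisenberg_def)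

lemma proj_one [simp]: "proj \<one>\<^bsub>heisenberg\<^esub> = 0"
  by (simp add: proj_def heisenberg_def zero_prod_def)

lemma height_one [simp]: "height \<one>\<^bsub>heisenberg\<^esub> = 0"
  by (simp add: height_def heisenberg_def)

lemma proj_inv [simp]:
  assumes "g \<in> carrier heisenberg"
  shows "proj (heis_inv g) = - proj g"
proof -
  have "proj (heis_inv g) + proj g = 0"
    using heis.l_inv[OF assms] by (metis proj_mult proj_one)
  then show ?thesis by (simp add: eq_neg_iff_add_eq_0)
qed

lemma height_inv [simp]:
  assumes "g \<in> carrier heisenberg"
  shows "height (heis_inv g) = - height g"
proof -
  have "height (heis_inv g) + height g + symp (- proj g) (proj g) = 0"
    using height_mult[of "heis_inv g" g] heis.l_inv[OF assms] proj_inv[OF assms] by simp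
  then show ?thesis
    by (simp add: symp_simps)
qed

lemma proj_lift [simp]: "proj (lift u) = u"
  by (simp add: proj_def lift_def)

lemma lift_closed [simp]: "lift u \<in> carrier heisenberg"
  by (simp add: lift_def heisenberg_def)

lemma proj_vert [simp]: "proj (vert d) = 0"
  by (simp add: proj_def vert_def zero_prod_def)

lemma height_vert [simp]: "height (vert d) = d"
  by (simp add: height_def vert_def)

lemma vert_closed_iff [simp]: "vert d \<in> carrier heisenberg \<longleftrightarrow> even d"
  by (simp add: vert_def heisenberg_def int_dot_simps)

lemma vert_add: "vert (d + e) = vert d \<cdot> vert e"
  by (rule heis_eqI) (simp_all add: height_mult symp_simps)

lemma even_height_diff:
  assumes "g \<in> carrier heisenberg" "h \<in> carrier heisenberg" "proj g = proj h"
  shows "even (height g - height h)"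
  using assms by (simp add: heis_carrier_iff)

text \<open>Fibres of the projection are cosets of the centre; by \<open>even_height_diff\<close>
  the central factor lies in the group when \<open>g\<close> and \<open>h\<close> do.\<close>

lemma mult_vert_height_diff:
  assumes "proj g = proj h"
  shows "g = h \<cdot> vert (height g - height h)"
  using assms by (intro heis_eqI) (simp_all add: height_mult symp_simps)

lemma projection_flip_mult:
  "projection_flip (g \<cdot> h) = projection_flip g \<cdot> projection_flip h"
  by (cases g; cases h) (simp add: projection_flip_def heisenberg_def int_dot_simps)

lemma projection_flip_closed:
  "g \<in> carrier heisenberg \<Longrightarrow> projection_flip g \<in> carrier heisenberg"
  by (cases g) (simp add: projection_flip_def heisenberg_def int_dot_simps)

lemma projection_flip_one: "projection_flip \<one>\<^bsub>heisenberg\<^esub> = \<one>\<^bsub>heisenberg\<^esub>"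
  by (simp add: projection_flip_def heisenberg_def)

lemma projection_flip_inv:
  assumes "g \<in> carrier heisenberg"
  shows "projection_flip (heis_inv g) = heis_inv (projection_flip g)"
  using assms
  by (intro heis.inv_equality[symmetric])
    (simp_all add: projection_flip_mult[symmetric] projection_flip_one projection_flip_closed)

lemma projection_flip_vert: "projection_flip (vert d) = vert d"
  by (simp add: projection_flip_def vert_def)

lemma proj_projection_flip: "proj (projection_flip g) = - proj g"
  by (cases g) (simp add: proj_def projection_flip_def)

text \<open>When \<open>\<bar>y\<bar>\<close> first reaches \<open>\<bar>t\<bar>\<close> it
  overshoots by at most \<open>K\<close>. Unboundedness gives no control over the sign of
  \<open>y\<close>, so both signs are allowed; replacing a generator by its inverse will absorb
  this.\<close>

lemma discrete_ivt_up_to_sign: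
  fixes y :: "nat \<Rightarrow> int"
  assumes "y 0 = 0" "\<And>r. \<bar>y (Suc r) - y r\<bar> \<le> K" "\<And>b. \<exists>r. \<bar>y r\<bar> > b" "K \<ge> 0"
  obtains r where "\<bar>t - y r\<bar> \<le> K \<or> \<bar>t + y r\<bar> \<le> K"
proof -
  define r where "r = (LEAST r. \<bar>y r\<bar> \<ge> \<bar>t\<bar>)"
  have "\<exists>r. \<bar>y r\<bar> \<ge> \<bar>t\<bar>" using assms(3) less_imp_le by blast
  then have ge: "\<bar>y r\<bar> \<ge> \<bar>t\<bar>" unfolding r_def by (rule LeastI_ex)
  have "\<bar>y r\<bar> \<le> \<bar>t\<bar> + K"
  proof (cases r)
    case 0
    then show ?thesis using assms by simp
  next
    case (Suc r')
    then have "\<bar>y r'\<bar> < \<bar>t\<bar>"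
      unfolding r_def by (metis lessI not_less_Least not_le)
    then show ?thesis using assms(2)[of r'] Suc by simp
  qed
  with ge show ?thesis by (intro that[of r]) linarith
qed

lemma inj_double: "inj (\<lambda>u :: (int ^ 'n) \<times> (int ^ 'n). u + u)"
  by (intro injI) (simp add: prod_eq_iff vec_eq_iff)

section \<open>Flip-invariant generators and halving of words\<close>

locale heisenberg_generators = symmetric_generators heisenberg S
  for S :: "'n::finite heis_elt set" +
  assumes flip_S: "projection_flip ` S = S"
begin

lemma len_projection_flip_le:
  assumes "g \<in> carrier heisenberg"
  shows "len (projection_flip g) \<le> len g"
proof -
  obtain ws where ws: "length ws = len g" "set ws \<subseteq> S" "word_prod ws = g"
    using ex_word assms by meson
  have "word_prod (map projection_flip ws) = projection_flip (word_prod ws)"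
    by (induction ws) (simp_all add: projection_flip_mult projection_flip_one)
  moreover have "set (map projection_flip ws) \<subseteq> S"
    using ws(2) flip_S by auto
  ultimately show ?thesis
    using len_le ws by (metis length_map)
qed

lemma word_dist_projection_flip_le:
  assumes "g \<in> carrier heisenberg" "h \<in> carrier heisenberg"
  shows "word_dist heisenberg S (projection_flip g) (projection_flip h) \<le> word_dist heisenberg S g h"
  using len_projection_flip_le[of "heis_inv g \<cdot> h"] assms
  by (simp add: word_dist_def projection_flip_mult projection_flip_inv)

text \<open>\<open>T\<close> collects the generators occurring an odd number of times in \<open>ws\<close>; counting it on the
  left of the length bound makes the induction go through.\<close>

lemma halve_word:
  assumes "set ws \<subseteq> S"
  shows "\<exists>vs T. set vs \<subseteq> S \<and> 2 * length vs + card T \<le> length ws \<and> T \<subseteq> S \<and>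
    proj (word_prod ws) = proj (word_prod vs) + proj (word_prod vs) + (\<Sum>s\<in>T. proj s)"
  using assms
proof (induction ws)
  case Nil
  show ?case by (intro exI[of _ "[]"] exI[of _ "{}"]) simp
next
  case (Cons s ws)
  then obtain vs T where IH: "set vs \<subseteq> S" "2 * length vs + card T \<le> length ws" "T \<subseteq> S"
    "proj (word_prod ws) = proj (word_prod vs) + proj (word_prod vs) + (\<Sum>s\<in>T. proj s)"
    by auto
  have fin: "finite T" using IH(3) finite_S by (rule finite_subset)
  show ?case
  proof (cases "s \<in> T")
    case True
    then have "(\<Sum>s\<in>T. proj s) = proj s + (\<Sum>s\<in>T - {s}. proj s)"
      using fin by (simp add: sum.remove)
    then have "proj (word_prod (s # ws)) =
        proj (word_prod (s # vs)) + proj (word_prod (s # vs)) + (\<Sum>s\<in>T - {s}. proj s)"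
      using IH(4) by (simp add: algebra_simps)
    moreover have "2 * length (s # vs) + card (T - {s}) \<le> length (s # ws)"
      using card.remove[OF fin True] IH(2) by simp
    ultimately show ?thesis
      using Cons.prems IH(1,3) by (intro exI[of _ "s # vs"] exI[of _ "T - {s}"]) auto
  next
    case False
    then show ?thesis
      using Cons.prems IH fin by (intro exI[of _ vs] exI[of _ "insert s T"]) (auto simp: algebra_simps)
  qed
qed

text \<open>The words from \<open>g\<close> and \<open>g'\<close> to \<open>p\<close> together have
  projection twice \<open>proj p\<close>. Halving their concatenation reaches \<open>proj p\<close>
  up to an error from a finite set depending only on \<open>S\<close>, so \<open>C\<close> is
  uniform in all the data.\<close>

lemma midpoint_projection:
  obtains C where
    "\<And>g g' p m. \<lbrakk>g \<in> carrier heisenberg; g' \<in> carrier heisenberg; p \<in> carrier heisenberg;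
       proj g + proj g' = 0; word_dist heisenberg S g p \<le> m; word_dist heisenberg S g' p \<le> m\<rbrakk> \<Longrightarrow>
       \<exists>q\<in>carrier heisenberg. proj q = proj p \<and> len q \<le> m + C"
proof -
  \<comment> \<open>The possible errors: halves of sums over subsets of \<open>S\<close>. Since
    doubling is injective, there are finitely many.\<close>
  define E where "E = (\<lambda>u. u + u) -` ((\<lambda>T. \<Sum>s\<in>T. proj s) ` Pow S)"
  have "finite E"
    unfolding E_def using finite_S by (intro finite_vimageI inj_double) simp
  then obtain C where C: "\<And>e. e \<in> E \<Longrightarrow> len (lift e) \<le> C"
    using finite_bounded_nat[of E "\<lambda>e. len (lift e)"] by blast
  show ?thesis
  proof (rule that[of C])
    fix g g' p :: "'n heis_elt" and m
    assume g: "g \<in> carrier heisenberg" "g' \<in> carrier heisenberg" "p \<in> carrier heisenberg"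
      and opp: "proj g + proj g' = 0"
      and d: "word_dist heisenberg S g p \<le> m" "word_dist heisenberg S g' p \<le> m"
    have "heis_inv g \<cdot> p \<in> carrier heisenberg" "heis_inv g' \<cdot> p \<in> carrier heisenberg"
      using g by simp_all
    then obtain w w' where
      "length w = len (heis_inv g \<cdot> p)" "set w \<subseteq> S" "word_prod w = heis_inv g \<cdot> p"
      "length w' = len (heis_inv g' \<cdot> p)" "set w' \<subseteq> S" "word_prod w' = heis_inv g' \<cdot> p"
      using ex_word by meson
    with d have w: "length w \<le> m" "set w \<subseteq> S" "word_prod w = heis_inv g \<cdot> p"
      "length w' \<le> m" "set w' \<subseteq> S" "word_prod w' = heis_inv g' \<cdot> p"
      by (simp_all only: word_dist_def)
    then obtain vs T where v: "set vs \<subseteq> S" "2 * length vs + card T \<le> length (w @ w')" "T \<subseteq> S"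
      "proj (word_prod (w @ w')) = proj (word_prod vs) + proj (word_prod vs) + (\<Sum>s\<in>T. proj s)"
      using halve_word[of "w @ w'"] by auto
    define e where "e = proj p - proj (word_prod vs)"
    have "proj (word_prod (w @ w')) = proj p + proj p - (proj g + proj g')"
      using w g word_prod_append[of w w'] by (simp add: algebra_simps)
    then have "proj p + proj p = proj (word_prod vs) + proj (word_prod vs) + (\<Sum>s\<in>T. proj s)"
      unfolding v(4) opp by simp
    then have "e + e = (\<Sum>s\<in>T. proj s)"
      by (simp add: e_def algebra_simps)
    then have "e \<in> E" using v(3) by (auto simp: E_def)
    then have "len (lift e) \<le> C" by (rule C)
    moreover have "length vs \<le> m" using v(2) w(1,4) by simp
    ultimately have "len (word_prod vs \<cdot> lift e) \<le> m + C"
      using len_mult[OF word_prod_closed[OF v(1)] lift_closed[of e]] len_le[OF v(1)] by linarith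
    then show "\<exists>q\<in>carrier heisenberg. proj q = proj p \<and> len q \<le> m + C"
      using word_prod_closed[OF v(1)]
      by (intro bexI[of _ "word_prod vs \<cdot> lift e"]) (auto simp: e_def)
  qed
qed

section \<open>Correcting the central coordinate along a path\<close>

text \<open>Nondegeneracy of the form: if every generator paired boundedly with \<open>U\<close>,
  then by additivity so would every group element. Pairing with lifted coordinate vectors would
  bound all coordinates of \<open>U\<close>, forcing \<open>U\<close> to be finite.\<close>

lemma ex_generator_symp_unbounded:
  assumes "infinite U"
  shows "\<exists>x\<in>S. \<forall>b. \<exists>u\<in>U. \<bar>symp (proj x) u\<bar> > b"
proof (rule ccontr)
  assume "\<not> ?thesis"
  then have bdd: "\<exists>b. \<forall>u\<in>U. \<bar>symp (proj x) u\<bar> \<le> b" if "x \<in> S" for x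
    using that by (meson not_le)
  have bdd': "\<exists>b. \<forall>u\<in>U. \<bar>symp (proj x) u\<bar> \<le> b" if "x \<in> carrier heisenberg" for x
    using that unfolding generate_S[symmetric]
  proof induction
    case one
    show ?case by (auto simp: symp_simps)
  next
    case (incl h)
    then show ?case by (rule bdd)
  next
    case (inv h)
    then have "h \<in> carrier heisenberg" using S_subset by blast
    then show ?case using bdd[OF inv] by (simp add: symp_simps)
  next
    case (eng h1 h2)
    then obtain b1 b2 where
      "\<forall>u\<in>U. \<bar>symp (proj h1) u\<bar> \<le> b1" "\<forall>u\<in>U. \<bar>symp (proj h2) u\<bar> \<le> b2"
      by auto
    then have "\<forall>u\<in>U. \<bar>symp (proj (h1 \<cdot> h2)) u\<bar> \<le> b1 + b2"
      by (force simp: symp_simps)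
    then show ?case by blast
  qed
  have dot_axis: "int_dot (axis i 1) b = b $ i" for b :: "int ^ 'n" and i
    by (simp add: int_dot_def axis_def if_distrib[of "\<lambda>x. x * _"] cong: if_cong)
  have "\<exists>c. \<forall>u\<in>U. \<bar>snd u $ i\<bar> \<le> c" for i
    using bdd'[of "lift (axis i 1, 0)"] by (simp add: symp_def dot_axis int_dot_simps)
  then obtain c1 where c1: "\<And>i u. u \<in> U \<Longrightarrow> \<bar>snd u $ i\<bar> \<le> c1 i"
    by metis
  have "\<exists>c. \<forall>u\<in>U. \<bar>fst u $ i\<bar> \<le> c" for i
    using bdd'[of "lift (0, axis i 1)"]
    by (simp add: symp_def dot_axis int_dot_simps int_dot_commute[of _ "axis i 1"])
  then obtain c2 where c2: "\<And>i u. u \<in> U \<Longrightarrow> \<bar>fst u $ i\<bar> \<le> c2 i"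
    by metis
  define box where "box c = vec_lambda ` PiE (UNIV :: 'n set) (\<lambda>i. {- c i..c i})" for c :: "'n \<Rightarrow> int"
  have in_box: "v \<in> box c" if "\<And>i. \<bar>v $ i\<bar> \<le> c i" for v c
    unfolding box_def using that
    by (intro image_eqI[of _ _ "vec_nth v"]) (auto simp: abs_le_iff minus_le_iff)
  have "U \<subseteq> box c2 \<times> box c1"
    using c1 c2 in_box by force
  moreover have "finite (box c)" for c
    unfolding box_def by (intro finite_imageI finite_PiE) auto
  ultimately show False
    using assms finite_subset by blast
qed

text \<open>The element \<open>q\<close> sits over \<open>p M\<close> but possibly at the wrong
  height. Following the path from \<open>M\<close> to \<open>m\<close>, conjugated by a suitable
  generator, repairs the height up to a bounded error, at the cost of two extra letters. The
  constant depends only on \<open>S\<close>.\<close>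

lemma path_len_le_projection:
  obtains C where
    "\<And>p M q. \<lbrakk>\<And>i. p i \<in> carrier heisenberg; \<And>i. p (Suc i) \<in> p i <#\<^bsub>heisenberg\<^esub> S;
       infinite (range (\<lambda>i. proj (p i))); q \<in> carrier heisenberg; proj q = proj (p M)\<rbrakk> \<Longrightarrow>
       \<exists>m\<ge>M. len (p m) \<le> len q + (m - M) + C"
proof -
  obtain K where K: "K \<ge> 0"
    "\<And>z. z \<in> S \<times> S \<Longrightarrow> \<bar>symp (proj (fst z)) (proj (snd z))\<bar> \<le> K"
    using finite_bounded_int[of "S \<times> S" "\<lambda>z. symp (proj (fst z)) (proj (snd z))"] finite_S by blast
  \<comment> \<open>The height error left after the repair is at most \<open>2 * K\<close> in
    absolute value.\<close>
  obtain C where C: "\<And>d. d \<in> {- 2 * K..2 * K} \<Longrightarrow> len (vert d) \<le> C"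
    using finite_bounded_nat[of "{- 2 * K..2 * K}" "\<lambda>d. len (vert d)"] by blast
  show ?thesis
  proof (rule that[of "C + 2"])
    fix p :: "nat \<Rightarrow> 'n heis_elt" and M q
    assume pc: "\<And>i. p i \<in> carrier heisenberg"
      and step: "\<And>i. p (Suc i) \<in> p i <#\<^bsub>heisenberg\<^esub> S"
      and inf: "infinite (range (\<lambda>i. proj (p i)))"
      and qc: "q \<in> carrier heisenberg" and pq: "proj q = proj (p M)"
    define u where "u r = proj (p (M + r)) - proj (p M)" for r
    have "infinite (range u)"
    proof
      assume "finite (range u)"
      moreover have "proj (p i) \<in> (\<lambda>i. proj (p i)) ` {..<M} \<union> (\<lambda>v. v + proj (p M)) ` range u" for i
      proof (cases "i < M")
        case False
        then have "proj (p i) = u (i - M) + proj (p M)" by (simp add: u_def)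
        then show ?thesis by blast
      qed simp
      ultimately show False
        using inf finite_subset[OF image_subsetI] by (metis (no_types, lifting) finite_Un finite_imageI finite_lessThan)
    qed
    then obtain x where x: "x \<in> S" "\<And>b. \<exists>r. \<bar>symp (proj x) (u r)\<bar> > b"
      using ex_generator_symp_unbounded[of "range u"] by auto
    have xc: "x \<in> carrier heisenberg" using x S_subset by auto
    have "even (height (p M) - height q)"
      using even_height_diff pc qc pq by metis
    then obtain t where t: "height (p M) - height q = 2 * t" by blast
    have small: "\<bar>symp (proj x) (u (Suc r)) - symp (proj x) (u r)\<bar> \<le> K" for r
    proof -
      obtain s where s: "s \<in> S" "p (Suc (M + r)) = p (M + r) \<cdot> s"
        using step[of "M + r"] by (auto simp: l_coset_def)
      then have "u (Suc r) = u r + proj s" by (simp add: u_def)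
      then show ?thesis using K(2)[of "(x, s)"] s(1) x(1) by (simp add: symp_simps)
    qed
    obtain r where "\<bar>t - symp (proj x) (u r)\<bar> \<le> K \<or> \<bar>t + symp (proj x) (u r)\<bar> \<le> K"
    proof (rule discrete_ivt_up_to_sign[where y = "\<lambda>r. symp (proj x) (u r)" and K = K])
      show "symp (proj x) (u 0) = 0" by (simp add: u_def symp_simps)
    qed (use small x(2) K(1) in auto)
    \<comment> \<open>Passing from \<open>x\<close> to its inverse changes the sign of the pairing,
      so one of the two generators serves as \<open>z\<close>.\<close>
    moreover have "\<bar>t + symp (proj x) (u r)\<bar> = \<bar>t - symp (proj (heis_inv x)) (u r)\<bar>"
      using xc by (simp add: symp_simps)
    ultimately obtain z where z: "z \<in> S" "\<bar>t - symp (proj z) (u r)\<bar> \<le> K"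
      using x(1) inv_S by metis
    have zc: "z \<in> carrier heisenberg" using z S_subset by auto
    define v where "v = heis_inv (p M) \<cdot> p (M + r)"
    \<comment> \<open>Conjugating \<open>v\<close> by \<open>z\<close> raises its height by
      \<open>2 * symp (proj z) (u r)\<close>; \<open>d\<close> is what remains of the deficit
      \<open>2 * t\<close>.\<close>
    define d where "d = 2 * (t - symp (proj z) (u r))"
    have vc: "v \<in> carrier heisenberg" using pc by (simp add: v_def)
    have pv: "proj v = u r" using pc by (simp add: v_def u_def)
    have "p (M + r) = q \<cdot> z \<cdot> v \<cdot> heis_inv z \<cdot> vert d"
    proof (rule heis_eqI)
      show "proj (p (M + r)) = proj (q \<cdot> z \<cdot> v \<cdot> heis_inv z \<cdot> vert d)"
        using zc pv pq by (simp add: u_def)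
      have "p (M + r) = p M \<cdot> v"
        using pc[of M] pc[of "M + r"] by (simp add: v_def heis.m_assoc[symmetric])
      then have "height (p (M + r)) = height (p M) + height v + symp (proj (p M)) (u r)"
        by (simp add: height_mult pv)
      then show "height (p (M + r)) = height (q \<cdot> z \<cdot> v \<cdot> heis_inv z \<cdot> vert d)"
        using zc t symp_swap[of "u r" "proj z"]
        by (simp add: height_mult pv pq symp_simps d_def)
    qed
    moreover have "len (q \<cdot> z \<cdot> v \<cdot> heis_inv z \<cdot> vert d)
        \<le> len q + len z + len v + len (heis_inv z) + len (vert d)"
    proof -
      have "even d" by (simp add: d_def)
      then show ?thesis
        using len_mult[of "q \<cdot> z \<cdot> v \<cdot> heis_inv z" "vert d"] len_mult[of "q \<cdot> z \<cdot> v" "heis_inv z"]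
          len_mult[of "q \<cdot> z" v] len_mult[of q z] qc zc vc by simp
    qed
    moreover have "len z \<le> 1" "len (heis_inv z) \<le> 1"
      using len_generator z(1) inv_S by auto
    moreover have "len v \<le> r"
      using path_word_dist_le[of p M "M + r"] pc step by (simp add: v_def word_dist_def)
    moreover have "len (vert d) \<le> C"
      using z(2) by (intro C) (auto simp: d_def)
    ultimately show "\<exists>m\<ge>M. len (p m) \<le> len q + (m - M) + (C + 2)"
      by (intro exI[of _ "M + r"]) simp
  qed
qed

section \<open>Distortion of the centre and projections of geodesics\<close>

text \<open>Sublinearity stated over the integers: the slope \<open>L / (2 * a)\<close> becomes
  arbitrarily small because \<open>L\<close> does not depend on \<open>a\<close>. Blocks of height
  \<open>2 * a^2\<close> cost at most \<open>a * L\<close> letters each, and \<open>d\<close> is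
  divided by this block size with remainder.\<close>

lemma len_vert_sublinear:
  obtains L :: nat where
    "\<And>a :: nat. a > 0 \<Longrightarrow> \<exists>C. \<forall>d. even d \<longrightarrow> 2 * int a * int (len (vert d)) \<le> int L * \<bar>d\<bar> + C"
proof -
  obtain i :: 'n where True by simp
  define x :: "int \<Rightarrow> 'n heis_elt" where "x t = (axis i t, 0, 0)" for t
  define y :: "int \<Rightarrow> 'n heis_elt" where "y t = (0, axis i t, 0)" for t
  have dot_axis: "int_dot (axis i s) (axis i t) = s * t" for s t :: int
    by (simp add: int_dot_def axis_def if_distrib[of "\<lambda>x. x * _"] cong: if_cong)
  have axis_add: "axis i (s + t) = axis i s + axis i t" for s t :: int
    by (simp add: axis_def vec_eq_iff)
  have closed: "x t \<in> carrier heisenberg" "y t \<in> carrier heisenberg" for t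
    by (simp_all add: x_def y_def heisenberg_def int_dot_simps)
  have x_add: "x (s + t) = x s \<cdot> x t" and y_add: "y (s + t) = y s \<cdot> y t" for s t
    by (simp_all add: x_def y_def heisenberg_def int_dot_simps axis_add)
  have axis_zero: "axis i (0 :: int) = 0" by (simp add: axis_def vec_eq_iff)
  have zero: "x 0 = \<one>\<^bsub>heisenberg\<^esub>" "y 0 = \<one>\<^bsub>heisenberg\<^esub>"
    by (simp_all add: x_def y_def heisenberg_def axis_zero)
  have len_x: "len (x (int a)) \<le> a * len (x 1)" for a
  proof (induction a)
    case (Suc a)
    then show ?case
      using len_mult[of "x (int a)" "x 1"] closed x_add[of "int a" 1] by (simp add: add.commute)
  qed (simp add: zero len_one)
  have len_y: "len (y (int a)) \<le> a * len (y 1)" for a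
  proof (induction a)
    case (Suc a)
    then show ?case
      using len_mult[of "y (int a)" "y 1"] closed y_add[of "int a" 1] by (simp add: add.commute)
  qed (simp add: zero len_one)
  define L where "L = 2 * (len (x 1) + len (y 1))"
  \<comment> \<open>Commutators of \<open>a\<close>-th powers reach central height of order \<open>a\<^sup>2\<close> with \<open>O(a)\<close> letters.\<close>
  have commutator: "vert (2 * int a ^ 2) =
      x (int a) \<cdot> y (int a) \<cdot> (heis_inv (x (int a)) \<cdot> heis_inv (y (int a)))" for a :: nat
  proof (rule heis_eqI)
    show "height (vert (2 * int a ^ 2)) =
        height (x (int a) \<cdot> y (int a) \<cdot> (heis_inv (x (int a)) \<cdot> heis_inv (y (int a))))"
      using closed
      by (simp add: height_mult symp_simps symp_swap[of "proj (y _)" "proj (x _)"])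
        (simp add: height_def x_def y_def symp_def proj_def int_dot_simps dot_axis power2_eq_square)
  qed (use closed in simp)
  have len_square: "len (vert (2 * int a ^ 2)) \<le> a * L" for a
  proof -
    have "len (vert (2 * int a ^ 2)) \<le> 2 * len (x (int a)) + 2 * len (y (int a))"
      unfolding commutator
      using len_mult[of "x (int a) \<cdot> y (int a)" "heis_inv (x (int a)) \<cdot> heis_inv (y (int a))"]
        len_mult[of "x (int a)" "y (int a)"] len_mult[of "heis_inv (x (int a))" "heis_inv (y (int a))"]
        len_inv[of "x (int a)"] len_inv[of "y (int a)"] closed by simp
    then show ?thesis using len_x[of a] len_y[of a] by (simp add: L_def algebra_simps)
  qed
  have len_multiple: "len (vert (int k * (2 * int a ^ 2))) \<le> k * (a * L)" for k a
  proof (induction k)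
    case 0
    then show ?case
      using len_one by (simp add: vert_def heisenberg_def)
  next
    case (Suc k)
    have "(vert (int (Suc k) * (2 * int a ^ 2)) :: 'n heis_elt) =
        vert (int k * (2 * int a ^ 2)) \<cdot> vert (2 * int a ^ 2)"
      by (simp add: vert_add[symmetric] algebra_simps)
    then show ?case
      using len_mult[of "vert (int k * (2 * int a ^ 2))" "vert (2 * int a ^ 2)"] Suc len_square[of a]
      by (simp del: of_nat_Suc)
  qed
  have "\<exists>C. \<forall>d. even d \<longrightarrow> 2 * int a * int (len (vert d)) \<le> int L * \<bar>d\<bar> + C" if a: "a > 0" for a :: nat
  proof -
    obtain C where C: "\<And>d. d \<in> {0..2 * int a ^ 2} \<Longrightarrow> len (vert d) \<le> C"
      using finite_bounded_nat[of "{0..2 * int a ^ 2}" "\<lambda>d. len (vert d)"] by blast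
    have nonneg: "2 * int a * int (len (vert d)) \<le> int L * d + 2 * int a * int C"
      if "even d" "d \<ge> 0" for d
    proof -
      define k where "k = nat (d div (2 * int a ^ 2))"
      define b where "b = d mod (2 * int a ^ 2)"
      have pos: "2 * int a ^ 2 > 0" using a by simp
      have d: "d = int k * (2 * int a ^ 2) + b"
        using div_mult_mod_eq[of d "2 * int a ^ 2"] that(2) pos
        by (simp add: k_def b_def pos_imp_zdiv_nonneg_iff)
      have b: "b \<ge> 0" "b \<le> 2 * int a ^ 2"
        using pos by (simp_all add: b_def less_imp_le)
      have "even b" using that d by simp
      then have "len (vert d) \<le> k * (a * L) + C"
        unfolding d vert_add
        using len_mult[of "vert (int k * (2 * int a ^ 2))" "vert b"] len_multiple[of k a] C[of b] b
        by simp
      then have "int (len (vert d)) \<le> int (k * (a * L) + C)" by linarith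
      then have "2 * int a * int (len (vert d)) \<le> 2 * int a * int (k * (a * L) + C)"
        by (intro mult_left_mono) auto
      also have "\<dots> = int L * (d - b) + 2 * int a * int C"
        by (simp add: d algebra_simps power2_eq_square)
      also have "\<dots> \<le> int L * d + 2 * int a * int C"
        using b by (simp add: mult_left_mono)
      finally show ?thesis .
    qed
    have "len (vert (- d)) = len (vert d)" if "even d" for d
    proof -
      have "heis_inv (vert d) = (vert (- d) :: 'n heis_elt)"
        using that by (intro heis_eqI) simp_all
      then show ?thesis using len_inv[of "vert d"] that by simp
    qed
    then have "2 * int a * int (len (vert d)) \<le> int L * \<bar>d\<bar> + 2 * int a * int C" if "even d" for d
      using nonneg[of "\<bar>d\<bar>"] that by (cases "d \<ge> 0") auto
    then show ?thesis by blast
  qed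
  then show ?thesis by (rule that)
qed

text \<open>If only finitely many projections occurred, the height would grow at most linearly, and
  up to a bounded factor \<open>p m\<close> would differ from \<open>p 0\<close> by a central
  element of that height. Its length would then be at most a small multiple of \<open>m\<close> plus
  a constant, whereas a geodesic requires length \<open>m\<close>.\<close>

lemma infinite_geodesic_projection:
  assumes "infinite_geodesic heisenberg S p"
  shows "infinite (range (\<lambda>i. proj (p i)))"
proof
  assume fin: "finite (range (\<lambda>i. proj (p i)))"
  have pc: "p i \<in> carrier heisenberg" and step: "p (Suc i) \<in> p i <#\<^bsub>heisenberg\<^esub> S"
    and dist: "word_dist heisenberg S (p 0) (p i) = i" for i
    using assms by (auto simp: infinite_geodesic_def)
  define U where "U = range (\<lambda>i. proj (p i))"
  have U: "finite U" "\<And>i. proj (p i) \<in> U" using fin by (auto simp: U_def)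
  \<comment> \<open>One step from a point over \<open>U\<close> along \<open>S\<close> changes the
    height by one of finitely many values.\<close>
  obtain K where K: "K \<ge> 0"
    "\<And>z. z \<in> U \<times> S \<Longrightarrow> \<bar>height (snd z) + symp (fst z) (proj (snd z))\<bar> \<le> K"
    using finite_bounded_int[of "U \<times> S" "\<lambda>z. height (snd z) + symp (fst z) (proj (snd z))"]
      U finite_S by blast
  have height_linear: "\<bar>height (p m) - height (p 0)\<bar> \<le> K * int m" for m
  proof (induction m)
    case (Suc m)
    obtain s where s: "s \<in> S" "p (Suc m) = p m \<cdot> s"
      using step[of m] by (auto simp: l_coset_def)
    then have "\<bar>height (p (Suc m)) - height (p m)\<bar> \<le> K"
      using K(2)[of "(proj (p m), s)"] U(2) by (simp add: height_mult)
    then show ?case using Suc by (simp add: algebra_simps)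
  qed simp
  define e where "e v = v - proj (p 0)" for v
  obtain K1 where K1: "\<And>v. v \<in> U \<Longrightarrow> \<bar>symp (proj (p 0)) v + height (lift (e v))\<bar> \<le> K1"
    using finite_bounded_int[OF U(1), of "\<lambda>v. symp (proj (p 0)) v + height (lift (e v))"] by blast
  obtain K2 where K2: "\<And>v. v \<in> U \<Longrightarrow> len (lift (e v)) \<le> K2"
    using finite_bounded_nat[OF U(1), of "\<lambda>v. len (lift (e v))"] by blast
  obtain L :: nat where L: "\<And>a :: nat. a > 0 \<Longrightarrow>
      \<exists>C. \<forall>d. even d \<longrightarrow> 2 * int a * int (len (vert d)) \<le> int L * \<bar>d\<bar> + C"
    using len_vert_sublinear by blast
  \<comment> \<open>Chosen with \<open>a > L * K\<close>, so that the central part has length at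
    most about \<open>L * K * m / (2 * a)\<close>, which is below \<open>m / 2\<close> for positive
    \<open>m\<close>.\<close>
  define a where "a = L * nat K + 1"
  have a: "int a = int L * K + 1" using K(1) by (simp add: a_def)
  obtain C where C: "\<And>d. even d \<Longrightarrow> 2 * int a * int (len (vert d)) \<le> int L * \<bar>d\<bar> + C"
    using L[of a] by (auto simp: a_def)
  define B where "B = 2 * int a * int K2 + int L * K1 + C"
  have "int m \<le> B" for m
  proof -
    define g where "g = heis_inv (p 0) \<cdot> p m"
    define h where "h = lift (e (proj (p m)))"
    define d where "d = height g - height h"
    have gc: "g \<in> carrier heisenberg" and hc: "h \<in> carrier heisenberg"
      using pc by (simp_all add: g_def h_def)
    have gh: "proj g = proj h"
      using pc by (simp add: g_def h_def e_def)
    have ev: "even d"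
      unfolding d_def by (rule even_height_diff[OF gc hc gh])
    have "g = h \<cdot> vert d"
      unfolding d_def by (rule mult_vert_height_diff[OF gh])
    then have "len g \<le> len h + len (vert d)"
      using len_mult[of h "vert d"] ev hc by simp
    moreover have "len g = m" using dist[of m] by (simp add: g_def word_dist_def)
    moreover have "len h \<le> K2" using K2[OF U(2)[of m]] by (simp add: h_def)
    ultimately have "int m \<le> int K2 + int (len (vert d))" by linarith
    then have "2 * int a * int m \<le> 2 * int a * (int K2 + int (len (vert d)))"
      by (intro mult_left_mono) auto
    also have "\<dots> \<le> 2 * int a * int K2 + (int L * \<bar>d\<bar> + C)"
      using C[OF ev] by (simp add: algebra_simps)
    finally have 1: "2 * int a * int m \<le> 2 * int a * int K2 + int L * \<bar>d\<bar> + C" by simp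
    have "d = height (p m) - height (p 0) - (symp (proj (p 0)) (proj (p m)) + height h)"
      using pc by (simp add: d_def g_def height_mult symp_simps)
    then have "\<bar>d\<bar> \<le> K * int m + K1"
      using height_linear[of m] K1[OF U(2)[of m]] unfolding h_def by linarith
    then have "int L * \<bar>d\<bar> \<le> int L * (K * int m + K1)"
      by (intro mult_left_mono) auto
    with 1 have "2 * int a * int m \<le> B + int L * K * int m"
      by (simp add: B_def algebra_simps)
    then have "int L * K * int m + 2 * int m \<le> B"
      unfolding a by (simp add: algebra_simps)
    moreover have "int L * K * int m \<ge> 0" using K(1) by simp
    ultimately show ?thesis by linarith
  qed
  from this[of "nat B + 1"] show False by (simp split: if_splits)
qed

section \<open>Busemann horoballs containing a point and its flip\<close>

text \<open>The essential point is uniformity: \<open>C\<close> is fixed before the horoball, its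
  geodesic and the point \<open>g\<close>, so one bound serves a whole sequence of
  horoballs.\<close>

lemma busemann_horoball_len:
  obtains C where
    "\<And>Q g k. \<lbrakk>busemann_horoball heisenberg S Q; g \<in> Q; projection_flip g \<in> Q;
       \<And>h. \<lbrakk>h \<in> carrier heisenberg; len h \<le> k\<rbrakk> \<Longrightarrow> h \<notin> Q\<rbrakk> \<Longrightarrow> k < C"
proof -
  obtain C1 where C1:
    "\<And>g g' p m. \<lbrakk>g \<in> carrier heisenberg; g' \<in> carrier heisenberg; p \<in> carrier heisenberg;
       proj g + proj g' = 0; word_dist heisenberg S g p \<le> m; word_dist heisenberg S g' p \<le> m\<rbrakk> \<Longrightarrow>
       \<exists>q\<in>carrier heisenberg. proj q = proj p \<and> len q \<le> m + C1"
    using midpoint_projection by blast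
  obtain C2 where C2:
    "\<And>p M q. \<lbrakk>\<And>i. p i \<in> carrier heisenberg; \<And>i. p (Suc i) \<in> p i <#\<^bsub>heisenberg\<^esub> S;
       infinite (range (\<lambda>i. proj (p i))); q \<in> carrier heisenberg; proj q = proj (p M)\<rbrakk> \<Longrightarrow>
       \<exists>m\<ge>M. len (p m) \<le> len q + (m - M) + C2"
    using path_len_le_projection by blast
  show ?thesis
  proof (rule that[of "C1 + C2 + 1"], rule ccontr)
    fix Q g k
    assume Q: "busemann_horoball heisenberg S Q" "g \<in> Q" "projection_flip g \<in> Q"
      and far: "\<And>h. \<lbrakk>h \<in> carrier heisenberg; len h \<le> k\<rbrakk> \<Longrightarrow> h \<notin> Q"
      and "\<not> k < C1 + C2 + 1"
    then have k: "C1 + C2 < k" by simp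
    obtain p where p: "infinite_geodesic heisenberg S p"
      and Q_eq: "Q = (\<Union>m. word_ball heisenberg S m (p m))"
      using Q(1) by (auto simp: busemann_horoball_def)
    have pc: "p i \<in> carrier heisenberg" and step: "p (Suc i) \<in> p i <#\<^bsub>heisenberg\<^esub> S" for i
      using p by (auto simp: infinite_geodesic_def)
    \<comment> \<open>The balls along the geodesic are nested, so both points can be tested against
      the same \<open>p M\<close>.\<close>
    have eventually_near: "\<exists>M. \<forall>m\<ge>M. h \<in> carrier heisenberg \<and> word_dist heisenberg S h (p m) \<le> m"
      if h: "h \<in> Q" for h
    proof -
      obtain M where M: "h \<in> carrier heisenberg" "word_dist heisenberg S (p M) h \<le> M"
        using h by (auto simp: Q_eq word_ball_def)
      have "word_dist heisenberg S h (p m) \<le> m" if "m \<ge> M" for m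
        using word_dist_triangle[of h "p M" "p m"] path_word_dist_le[of p M m] M pc step that
          word_dist_commute[of h "p M"] by simp
      then show ?thesis using M(1) by blast
    qed
    obtain M1 M2 where
      M1: "\<And>m. m \<ge> M1 \<Longrightarrow> g \<in> carrier heisenberg \<and> word_dist heisenberg S g (p m) \<le> m" and
      M2: "\<And>m. m \<ge> M2 \<Longrightarrow> word_dist heisenberg S (projection_flip g) (p m) \<le> m"
      using eventually_near[OF Q(2)] eventually_near[OF Q(3)] by blast
    define M where "M = max M1 M2"
    have M: "g \<in> carrier heisenberg" "word_dist heisenberg S g (p M) \<le> M"
      "projection_flip g \<in> carrier heisenberg" "word_dist heisenberg S (projection_flip g) (p M) \<le> M"
      using M1[of M] M2[of M] projection_flip_closed[of g] by (simp_all add: M_def)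
    obtain q where q: "q \<in> carrier heisenberg" "proj q = proj (p M)" "len q \<le> M + C1"
      using C1[OF M(1,3) pc _ M(2,4)] by (auto simp: proj_projection_flip)
    then obtain m where m: "m \<ge> M" "len (p m) \<le> len q + (m - M) + C2"
      using C2[OF pc step infinite_geodesic_projection[OF p], of q M] by blast
    then have bound: "len (p m) \<le> m + k" using q(3) k by linarith
    \<comment> \<open>Stopping after \<open>k\<close> letters on a shortest word for
      \<open>p m\<close> leaves distance at most \<open>m\<close>; if \<open>p m\<close> is shorter
      than \<open>k\<close>, it serves as \<open>h\<close> itself.\<close>
    have "\<exists>h\<in>carrier heisenberg. len h \<le> k \<and> word_dist heisenberg S h (p m) \<le> m"
    proof (cases "k \<le> len (p m)")
      case True
      obtain h where h: "h \<in> carrier heisenberg" "len h \<le> k"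
        "word_dist heisenberg S h (p m) \<le> len (p m) - k"
        by (rule len_split[OF pc True])
      then have "word_dist heisenberg S h (p m) \<le> m" using bound by linarith
      with h show ?thesis by blast
    next
      case False
      then show ?thesis
        using pc by (intro bexI[of _ "p m"]) (simp_all add: word_dist_def len_one)
    qed
    then obtain h where h: "h \<in> carrier heisenberg" "len h \<le> k"
      "word_dist heisenberg S h (p m) \<le> m"
      by blast
    then have "h \<in> Q"
      using word_dist_commute[of h "p m"] pc by (auto simp: Q_eq word_ball_def)
    then show False using far h by blast
  qed
qed

section \<open>Construction of a flip-invariant horoball\<close>

lemma ex_flip_invariant_horoball:
  obtains P where "horoball heisenberg S P"
    "\<And>h. \<lbrakk>h \<in> carrier heisenberg; len h \<le> k\<rbrakk> \<Longrightarrow> h \<notin> P"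
    "\<And>h. h \<in> P \<Longrightarrow> projection_flip h \<in> P"
proof -
  \<comment> \<open>Balls are finite, while there are infinitely many central elements.\<close>
  have "\<exists>d. even d \<and> len (vert d) \<ge> l" for l
  proof (rule ccontr)
    assume neg: "\<not> ?thesis"
    define v :: "nat \<Rightarrow> 'n heis_elt" where "v n = vert (2 * int n)" for n
    have "range v \<subseteq> {g \<in> carrier heisenberg. len g \<le> l}"
    proof (rule image_subsetI)
      fix n
      have "\<not> l \<le> len (v n)" using neg by (auto simp: v_def)
      then show "v n \<in> {g \<in> carrier heisenberg. len g \<le> l}" by (simp add: v_def)
    qed
    then have "finite (range v)"
      using finite_len_ball finite_subset by blast
    moreover have "inj v" by (auto simp: inj_on_def v_def vert_def)
    ultimately show False
      using finite_imageD infinite_UNIV_nat by blast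
  qed
  \<comment> \<open>The margin \<open>i\<close> makes the radii tend to infinity, and the summand
    \<open>k + 1\<close> keeps the natural subtraction in \<open>B\<close> exact.\<close>
  then have "\<forall>i. \<exists>d. even d \<and> len (vert d) \<ge> i + (k + 1)" by blast
  from choice[OF this] obtain d where
    d: "\<And>i. even (d i)" "\<And>i. len (vert (d i)) \<ge> i + (k + 1)"
    by blast
  define B where
    "B i = word_ball heisenberg S (len (vert (d i)) - (k + 1)) (vert (d i))" for i
  have vc: "vert (d i) \<in> carrier heisenberg" for i using d by simp
  obtain r P where r: "strict_mono r" and P: "P \<subseteq> carrier heisenberg"
    and lim: "\<And>x. x \<in> carrier heisenberg \<Longrightarrow>
      eventually (\<lambda>i. x \<in> B (r i) \<longleftrightarrow> x \<in> P) sequentially"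
    using countable_set_sequence_convergent_subsequence[OF countable_carrier] by blast
  have far_B: "h \<notin> B i" if "h \<in> carrier heisenberg" "len h \<le> k" for h i
  proof -
    have "len (vert (d i)) \<le> len h + word_dist heisenberg S (vert (d i)) h"
      using word_dist_triangle[of "\<one>\<^bsub>heisenberg\<^esub>" h "vert (d i)"] that(1) vc
        word_dist_one word_dist_commute[of h "vert (d i)"] by simp
    then show ?thesis
      using d(2)[of i] that(2) by (auto simp: B_def word_ball_def)
  qed
  have flip_B: "projection_flip h \<in> B i" if "h \<in> B i" for h i
    using that word_dist_projection_flip_le[of "vert (d i)" h] vc
    by (auto simp: B_def word_ball_def projection_flip_closed projection_flip_vert intro: le_trans)
  have near_B: "\<exists>h\<in>carrier heisenberg. len h \<le> k + 1 \<and> h \<in> B i" for i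
  proof -
    have "k + 1 \<le> len (vert (d i))" using d(2)[of i] by linarith
    then obtain h where "h \<in> carrier heisenberg" "len h \<le> k + 1"
      "word_dist heisenberg S h (vert (d i)) \<le> len (vert (d i)) - (k + 1)"
      by (rule len_split[OF vc])
    then show ?thesis
      using word_dist_commute[of h "vert (d i)"] vc by (auto simp: B_def word_ball_def)
  qed
  have far_P: "h \<notin> P" if "h \<in> carrier heisenberg" "len h \<le> k" for h
    using eventually_happens'[OF sequentially_bot lim[OF that(1)]] far_B[OF that] by blast
  have flip_P: "projection_flip h \<in> P" if "h \<in> P" for h
  proof -
    have "h \<in> carrier heisenberg" using that P by blast
    then have "eventually (\<lambda>i. (h \<in> B (r i) \<longleftrightarrow> h \<in> P) \<and>
        (projection_flip h \<in> B (r i) \<longleftrightarrow> projection_flip h \<in> P)) sequentially"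
      by (intro eventually_conj lim projection_flip_closed)
    then obtain i where "h \<in> B (r i) \<longleftrightarrow> h \<in> P"
      "projection_flip h \<in> B (r i) \<longleftrightarrow> projection_flip h \<in> P"
      using eventually_happens'[OF sequentially_bot] by blast
    then show ?thesis
      using that flip_B[of h "r i"] by blast
  qed
  \<comment> \<open>The point of \<open>B (r i)\<close> within \<open>k + 1\<close> of the identity
    may vary with \<open>i\<close>. As there are finitely many candidates, some index agrees with
    \<open>P\<close> on all of them.\<close>
  have "P \<noteq> {}"
  proof -
    let ?F = "{h \<in> carrier heisenberg. len h \<le> k + 1}"
    have "\<forall>h\<in>?F. eventually (\<lambda>i. h \<in> B (r i) \<longleftrightarrow> h \<in> P) sequentially"
      using lim by simp
    then have "eventually (\<lambda>i. \<forall>h\<in>?F. h \<in> B (r i) \<longleftrightarrow> h \<in> P) sequentially"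
      by (rule eventually_ball_finite[OF finite_len_ball])
    then obtain i where i: "\<forall>h\<in>?F. h \<in> B (r i) \<longleftrightarrow> h \<in> P"
      by (rule eventually_happens'[OF sequentially_bot, THEN exE])
    obtain h where "h \<in> ?F" "h \<in> B (r i)" using near_B[of "r i"] by auto
    then show ?thesis using i by blast
  qed
  moreover have "P \<noteq> carrier heisenberg"
    using far_P[of "\<one>\<^bsub>heisenberg\<^esub>"] len_one by auto
  moreover have "filterlim (\<lambda>i. len (vert (d (r i))) - (k + 1)) at_top sequentially"
  proof (rule filterlim_at_top_mono[OF filterlim_subseq[OF r]])
    show "eventually (\<lambda>i. r i \<le> len (vert (d (r i))) - (k + 1)) sequentially"
    proof (intro always_eventually allI)
      fix i
      show "r i \<le> len (vert (d (r i))) - (k + 1)"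
        using d(2)[of "r i"] by linarith
    qed
  qed
  moreover have "converges_to heisenberg
      (\<lambda>i. word_ball heisenberg S (len (vert (d (r i))) - (k + 1)) (vert (d (r i)))) P"
    using lim by (simp add: converges_to_def B_def)
  ultimately have "horoball heisenberg S P"
    unfolding horoball_def using P vc
    by (intro conjI exI[of _ "\<lambda>i. vert (d (r i))"]
        exI[of _ "\<lambda>i. len (vert (d (r i))) - (k + 1)"] allI)
  then show ?thesis using that far_P flip_P by blast
qed

section \<open>Separation from limits of Busemann horoballs\<close>

lemma ex_horoball_not_limit:
  "\<exists>P. horoball heisenberg S P \<and>
    \<not> (\<exists>Q. (\<forall>i. busemann_horoball heisenberg S (Q i)) \<and> converges_to heisenberg Q P)"
proof -
  obtain C where C:
    "\<And>Q g k. \<lbrakk>busemann_horoball heisenberg S Q; g \<in> Q; projection_flip g \<in> Q;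
       \<And>h. \<lbrakk>h \<in> carrier heisenberg; len h \<le> k\<rbrakk> \<Longrightarrow> h \<notin> Q\<rbrakk> \<Longrightarrow> k < C"
    using busemann_horoball_len by blast
  \<comment> \<open>The horoball avoids the ball of radius exactly \<open>C\<close>, so any Busemann
    horoball agreeing with it on \<open>?F\<close> below would yield \<open>C < C\<close>.\<close>
  obtain P where P: "horoball heisenberg S P"
    "\<And>h. \<lbrakk>h \<in> carrier heisenberg; len h \<le> C\<rbrakk> \<Longrightarrow> h \<notin> P"
    "\<And>h. h \<in> P \<Longrightarrow> projection_flip h \<in> P"
    using ex_flip_invariant_horoball[of C] by blast
  obtain g where g: "g \<in> P" "g \<in> carrier heisenberg"
    using P(1) by (auto simp: horoball_def)
  have False if Q: "\<And>i. busemann_horoball heisenberg S (Q i)" "converges_to heisenberg Q P" for Q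
  proof -
    let ?F = "{h \<in> carrier heisenberg. len h \<le> C} \<union> {g, projection_flip g}"
    have "eventually (\<lambda>i. \<forall>h\<in>?F. h \<in> Q i \<longleftrightarrow> h \<in> P) sequentially"
    proof (rule eventually_ball_finite)
      show "finite ?F" using finite_len_ball by simp
      have "?F \<subseteq> carrier heisenberg" using g(2) projection_flip_closed by blast
      then show "\<forall>h\<in>?F. eventually (\<lambda>i. h \<in> Q i \<longleftrightarrow> h \<in> P) sequentially"
        using Q(2) unfolding converges_to_def by blast
    qed
    then obtain i where i: "\<forall>h\<in>?F. h \<in> Q i \<longleftrightarrow> h \<in> P"
      by (rule eventually_happens'[OF sequentially_bot, THEN exE])
    have "C < C"
      by (rule C[OF Q(1)[of i], of g]) (use i g P in auto)
    then show False by simp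
  qed
  then show ?thesis using P(1) by blast
qed

end

theorem theorem3:
  fixes S :: "'n::finite heis_elt set"
  assumes "finite S"
    and "S \<subseteq> carrier heisenberg"
    and "generate heisenberg S = carrier heisenberg"
    and "S = {inv\<^bsub>heisenberg\<^esub> s | s. s \<in> S}"
    and "projection_flip ` S = S"
    and "\<one>\<^bsub>heisenberg\<^esub> \<in> S"
  shows "\<exists>P. horoball heisenberg S P \<and>
           \<not> (\<exists>Q. (\<forall>i. busemann_horoball heisenberg S (Q i)) \<and> converges_to heisenberg Q P)"
proof -
  interpret heisenberg_generators S
    by unfold_locales (use assms in blast)+
  show ?thesis by (rule ex_horoball_not_limit)
qed

end
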